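(* Let $d\ge2$ and $n_1,\dots,n_d\ge1$ be integers, let $\theta:\prod_{i=1}^d[n_i]\to\mathbb{R}$, and let $\overline\theta=\frac{1}{\prod_{i}n_i}\sum_{\mathbf{j}\in\prod_i[n_i]}\theta[\mathbf{j}]$ be the average of its entries. Then $$\sum_{\mathbf{j}\in\prod_{i=1}^d[n_i]}|\theta[\mathbf{j}]-\overline\theta|^{\frac{d}{d-1}}\le\Big(1+\max_{i,j\in[d]}\frac{n_i}{n_j}\Big)^{\frac{d}{d-1}}\mathrm{TV}(\theta)^{\frac{d}{d-1}}.$$ As a consequence, $$\sum_{\mathbf{j}\in\prod_{i=1}^d[n_i]}|\theta[\mathbf{j}]-\overline\theta|^{2}\le\Big(1+\max_{i,j\in[d]}\frac{n_i}{n_j}\Big)^{2}\mathrm{TV}(\theta)^{2}.$$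
   Context: $[m]=\{1,\dots,m\}$. $\mathrm{TV}(\theta)=\sum_{(u,v)}|\theta_u-\theta_v|$, the sum being over all edges of the graph induced on $\prod_{i=1}^d[n_i]$ by the lattice $\mathbb{Z}^d$ (vertices adjacent iff at $\ell_1$-distance 1), each edge counted once. *)

theory Defs
  imports "HOL-Analysis.Analysis"
begin

text \<open>Points of the box are extensional functions (\<open>undefined\<close> outside \<open>{1..d}\<close>),
  so that distinct box elements are distinct lattice points.\<close>

definition grid :: "nat \<Rightarrow> (nat \<Rightarrow> nat) \<Rightarrow> (nat \<Rightarrow> nat) set" where
  "grid d n = (\<Pi>\<^sub>E i\<in>{1..d}. {1..n i})"

definition l1_dist :: "nat \<Rightarrow> (nat \<Rightarrow> nat) \<Rightarrow> (nat \<Rightarrow> nat) \<Rightarrow> int" where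
  "l1_dist d u v = (\<Sum>i\<in>{1..d}. \<bar>int (u i) - int (v i)\<bar>)"

definition grid_edges :: "nat \<Rightarrow> (nat \<Rightarrow> nat) \<Rightarrow> (nat \<Rightarrow> nat) set set" where
  "grid_edges d n = {{u, v} | u v. u \<in> grid d n \<and> v \<in> grid d n \<and> l1_dist d u v = 1}"

text \<open>Edges are unordered pairs, hence each is counted once in the sum; the value at an edge
  is well defined by symmetry, see \<open>edge_diff_insert\<close>.\<close>

definition edge_diff :: "('a \<Rightarrow> real) \<Rightarrow> 'a set \<Rightarrow> real" where
  "edge_diff \<theta> e = (THE r. \<exists>u v. e = {u, v} \<and> r = \<bar>\<theta> u - \<theta> v\<bar>)"

definition TV :: "nat \<Rightarrow> (nat \<Rightarrow> nat) \<Rightarrow> ((nat \<Rightarrow> nat) \<Rightarrow> real) \<Rightarrow> real" where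
  "TV d n \<theta> = (\<Sum>e\<in>grid_edges d n. edge_diff \<theta> e)"

definition grid_mean :: "nat \<Rightarrow> (nat \<Rightarrow> nat) \<Rightarrow> ((nat \<Rightarrow> nat) \<Rightarrow> real) \<Rightarrow> real" where
  "grid_mean d n \<theta> = 1 / (\<Prod>i\<in>{1..d}. real (n i)) * (\<Sum>j\<in>grid d n. \<theta> j)"

definition aspect_ratio :: "nat \<Rightarrow> (nat \<Rightarrow> nat) \<Rightarrow> real" where
  "aspect_ratio d n = Max {real (n i) / real (n j) | i j. i \<in> {1..d} \<and> j \<in> {1..d}}"

lemma edge_diff_insert [simp]: "edge_diff \<theta> {u, v} = \<bar>\<theta> u - \<theta> v\<bar>"
  unfolding edge_diff_def
  by (rule the_equality) (auto simp: doubleton_eq_iff abs_minus_commute)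

lemma finite_grid [simp]: "finite (grid d n)"
  unfolding grid_def by (intro finite_PiE) auto

lemma finite_grid_edges [simp]: "finite (grid_edges d n)"
  by (rule finite_subset[of _ "Pow (grid d n)"]) (auto simp: grid_edges_def)

end

theory Submission
  imports Defs
begin

text \<open>
  For every direction \<open>i\<close>, the deviation \<open>\<bar>\<theta> x - mean\<bar>\<close> is at most a function \<open>g i x\<close> that does
  not depend on the coordinate \<open>x i\<close>: the variation of \<open>\<theta>\<close> along the line through \<open>x\<close> in
  direction \<open>i\<close>, plus the average over \<open>y\<close> of \<open>\<bar>\<theta> (x(i := y i)) - \<theta> y\<bar>\<close>. In the second term the
  coordinates other than \<open>i\<close> are changed one at a time; since exchanging a set of coordinates
  between \<open>x\<close> and \<open>y\<close> permutes the pairs \<open>(x, y)\<close>, changing coordinate \<open>k\<close> costs on average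
  \<open>n k\<close> times the variation \<open>TV\<^sub>k\<close> in direction \<open>k\<close>. Hence the sum of \<open>g i\<close> over the
  coordinates other than \<open>i\<close> is at most \<open>\<Sum>k. n k / n i * TV\<^sub>k\<close>, and the Loomis--Whitney
  inequality applied to the functions \<open>g i\<close> gives the first bound. The second one follows
  because \<open>d / (d - 1) \<le> 2\<close>.
\<close>

section \<open>Weighted means and Hoelder's inequality\<close>

lemma weighted_arith_geom_mean:
  fixes w x :: "'a \<Rightarrow> real"
  assumes "finite I" and w: "\<And>i. i \<in> I \<Longrightarrow> w i \<ge> 0" "sum w I = 1"
    and x: "\<And>i. i \<in> I \<Longrightarrow> x i \<ge> 0"
  shows "(\<Prod>i\<in>I. x i powr w i) \<le> (\<Sum>i\<in>I. w i * x i)"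
proof (cases "\<exists>i\<in>I. x i = 0")
  case True
  \<comment> \<open>\<open>0 powr w i\<close> is 0 for every weight, a zero weight included.\<close>
  then have "(\<Prod>i\<in>I. x i powr w i) = 0"
    using \<open>finite I\<close> by (auto intro!: prod_zero)
  then show ?thesis
    using w x by (simp add: sum_nonneg)
next
  case False
  with x have pos: "x i > 0" if "i \<in> I" for i
    using that by (metis order_le_less)
  have "I \<noteq> {}"
    using w by auto
  have "(\<Prod>i\<in>I. x i powr w i) = exp (\<Sum>i\<in>I. w i *\<^sub>R ln (x i))"
    using pos \<open>finite I\<close> by (force simp: exp_sum powr_def intro!: prod.cong)
  also have "\<dots> \<le> (\<Sum>i\<in>I. w i * exp (ln (x i)))"
    using w \<open>finite I\<close> \<open>I \<noteq> {}\<close> by (intro convex_on_sum[OF _ _ exp_convex]) auto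
  also have "\<dots> = (\<Sum>i\<in>I. w i * x i)"
    using pos by simp
  finally show ?thesis .
qed

text \<open>Hoelder's inequality for several factors, with exponents \<open>1 / w i\<close>. If no
  \<open>h i\<close> has sum 0, dividing each by its sum \<open>H i\<close> reduces it to weighted
  means: the product at \<open>t\<close> is at most a convex combination of the
  \<open>h i t / H i\<close>, each of which sums to 1 over \<open>T\<close>.\<close>

lemma sum_prod_powr_le_prod_sum_powr:
  fixes h :: "'a \<Rightarrow> 'b \<Rightarrow> real"
  assumes "finite I" "finite T" and w: "\<And>i. i \<in> I \<Longrightarrow> w i \<ge> 0" "sum w I = 1"
    and h: "\<And>i t. i \<in> I \<Longrightarrow> t \<in> T \<Longrightarrow> h i t \<ge> 0"
  shows "(\<Sum>t\<in>T. \<Prod>i\<in>I. h i t powr w i) \<le> (\<Prod>i\<in>I. (\<Sum>t\<in>T. h i t) powr w i)"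
proof (cases "\<exists>i\<in>I. (\<Sum>t\<in>T. h i t) = 0")
  case True
  then obtain i where i: "i \<in> I" "(\<Sum>t\<in>T. h i t) = 0"
    by blast
  then have "\<forall>t\<in>T. h i t = 0"
    using h \<open>finite T\<close> by (simp add: sum_nonneg_eq_0_iff)
  then have "(\<Sum>t\<in>T. \<Prod>i\<in>I. h i t powr w i) = 0"
    using i \<open>finite I\<close> by (intro sum.neutral ballI prod_zero) auto
  then show ?thesis
    by (simp add: prod_nonneg)
next
  case False
  define H where "H i = (\<Sum>t\<in>T. h i t)" for i
  have H: "H i > 0" if "i \<in> I" for i
    using False that h by (metis H_def order_le_less sum_nonneg)
  define P where "P = (\<Prod>i\<in>I. H i powr w i)"
  have "(\<Sum>t\<in>T. \<Prod>i\<in>I. h i t powr w i) = (\<Sum>t\<in>T. P * (\<Prod>i\<in>I. (h i t / H i) powr w i))"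
  proof (rule sum.cong[OF refl])
    fix t assume "t \<in> T"
    have "h i t powr w i = H i powr w i * (h i t / H i) powr w i" if "i \<in> I" for i
      using H[OF that] h[OF that \<open>t \<in> T\<close>] by (simp flip: powr_mult)
    then show "(\<Prod>i\<in>I. h i t powr w i) = P * (\<Prod>i\<in>I. (h i t / H i) powr w i)"
      unfolding P_def by (simp flip: prod.distrib)
  qed
  also have "\<dots> \<le> (\<Sum>t\<in>T. P * (\<Sum>i\<in>I. w i * (h i t / H i)))"
    using w h H \<open>finite I\<close>
    by (intro sum_mono mult_left_mono weighted_arith_geom_mean)
       (auto simp: P_def prod_nonneg intro!: divide_nonneg_pos)
  also have "\<dots> = P * (\<Sum>i\<in>I. w i * (\<Sum>t\<in>T. h i t / H i))"
    by (simp add: sum_distrib_left sum.swap[of _ T I])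
  also have "(\<Sum>i\<in>I. w i * (\<Sum>t\<in>T. h i t / H i)) = (\<Sum>i\<in>I. w i)"
    using H by (intro sum.cong) (force simp: H_def simp flip: sum_divide_distrib)+
  finally show ?thesis
    using w by (simp add: P_def H_def)
qed

section \<open>The Loomis--Whitney inequality for sums over finite boxes\<close>

lemma sum_PiE_insert:
  assumes "k \<notin> J"
  shows "sum f (PiE (insert k J) A) = (\<Sum>t\<in>A k. \<Sum>y\<in>PiE J A. f (y(k := t)))"
  unfolding PiE_insert_eq sum.reindex[OF inj_combinator[OF assms]] sum.cartesian_product
  by (simp add: case_prod_beta)

text \<open>Induction on the dimension. For a fixed value \<open>t\<close> of the new coordinate
  \<open>k\<close>, Hoelder's inequality separates \<open>g k\<close>, which does not see
  \<open>t\<close>, from the other factors, to which the induction hypothesis applies; Hoelder over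
  \<open>t\<close> then restores the full sums.\<close>

lemma Loomis_Whitney_sum:
  fixes g :: "'i \<Rightarrow> ('i \<Rightarrow> 'b) \<Rightarrow> real"
  assumes "finite I" "card I \<ge> 2" "\<And>i. i \<in> I \<Longrightarrow> finite (A i)"
    and "\<And>i x. i \<in> I \<Longrightarrow> g i x \<ge> 0"
    and "\<And>i x t. i \<in> I \<Longrightarrow> g i (x(i := t)) = g i x"
  shows "(\<Sum>x\<in>PiE I A. \<Prod>i\<in>I. g i x powr (1 / (real (card I) - 1)))
         \<le> (\<Prod>i\<in>I. (\<Sum>x\<in>PiE (I - {i}) A. g i x) powr (1 / (real (card I) - 1)))"
  using assms
proof (induction I arbitrary: g rule: finite_induct)
  case empty
  then show ?case by simp
next
  case (insert k J)
  define m where "m = real (card J)"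
  have m: "m \<ge> 1" "real (card (insert k J)) - 1 = m"
    using insert.prems(1) insert.hyps by (auto simp: m_def)
  have nonneg: "g i x \<ge> 0" if "i \<in> insert k J" for i x
    using insert.prems(3) that by blast
  have indep: "g i (x(i := t)) = g i x" if "i \<in> insert k J" for i x t
    using insert.prems(4) that by blast
  have finA: "finite (PiE S A)" if "S \<subseteq> J" for S
    using that insert.hyps insert.prems(2) by (intro finite_PiE) (auto dest: finite_subset)
  define G where "G = (\<Sum>y\<in>PiE J A. g k y)"
  define h where "h i t = (\<Sum>y\<in>PiE (J - {i}) A. g i (y(k := t)))" for i t
  have h0: "h i t \<ge> 0" if "i \<in> J" for i t
    unfolding h_def using that nonneg by (auto intro!: sum_nonneg)
  have slice: "(\<Sum>y\<in>PiE J A. \<Prod>i\<in>J. g i (y(k := t)) powr (1 / (m - 1)))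
      \<le> (\<Prod>i\<in>J. h i t powr (1 / (m - 1)))" if "m \<noteq> 1" for t
    unfolding h_def m_def
  proof (rule insert.IH)
    show "2 \<le> card J"
      using m(1) that by (simp add: m_def)
    show "g i ((y(i := s))(k := t)) = g i (y(k := t))" if "i \<in> J" for i y s
    proof -
      have "i \<noteq> k" using that insert.hyps by auto
      then have "(y(i := s))(k := t) = (y(k := t))(i := s)" by (rule fun_upd_twist)
      then show ?thesis using that by (simp add: indep)
    qed
  qed (use insert.prems in auto)
  have inner: "(\<Sum>y\<in>PiE J A. g k y powr (1/m) * (\<Prod>i\<in>J. g i (y(k := t)) powr (1/m)))
      \<le> G powr (1/m) * (\<Prod>i\<in>J. h i t powr (1/m))" for t
  proof (cases "m = 1")
    \<comment> \<open>Two-dimensional base case: with \<open>J = {i}\<close>, the value of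
      \<open>g i\<close> on the slice depends on \<open>t\<close> alone and factors out of the sum
      over \<open>y\<close>.\<close>
    case True
    then obtain i where J: "J = {i}"
      unfolding m_def by (metis card_1_singletonE of_nat_eq_1_iff)
    have "g i (y(k := t)) = h i t" if "y \<in> PiE J A" for y
    proof -
      have "y = (\<lambda>_. undefined)(i := y i)"
        using that by (auto simp: J PiE_def extensional_def)
      moreover have "i \<noteq> k" using J insert.hyps by auto
      ultimately have "y(k := t) = ((\<lambda>_. undefined)(k := t))(i := y i)"
        by (metis fun_upd_twist)
      then show ?thesis
        by (simp add: h_def J indep) (simp add: fun_upd_def)
    qed
    then show ?thesis
      using True nonneg h0 by (simp add: J G_def sum_distrib_right sum_nonneg)
  next
    case False
    with m have m1: "m > 1" by simp
    define P where "P y = (\<Prod>i\<in>J. g i (y(k := t)) powr (1 / (m - 1)))" for y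
    have P0: "P y \<ge> 0" for y
      unfolding P_def by (intro prod_nonneg) auto
    \<comment> \<open>Raising to \<open>(m - 1)/m\<close>, the weight complementary to
      \<open>1/m\<close>, turns the exponents \<open>1/(m - 1)\<close> of the induction hypothesis
      into \<open>1/m\<close>.\<close>
    have powP: "(\<Prod>i\<in>J. g i (y(k := t)) powr (1/m)) = P y powr ((m - 1)/m)" for y
      using m1 unfolding P_def by (simp add: prod_powr_distrib powr_powr)
    \<comment> \<open>Hoelder with the two factors \<open>g k\<close> and \<open>P\<close>, indexed
      by \<open>bool\<close> to fit the general lemma.\<close>
    have "(\<Sum>y\<in>PiE J A. g k y powr (1/m) * (\<Prod>i\<in>J. g i (y(k := t)) powr (1/m)))
        = (\<Sum>y\<in>PiE J A. \<Prod>b\<in>UNIV. (if b then g k y else P y) powr (if b then 1/m else (m-1)/m))"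
      by (simp add: powP UNIV_bool mult.commute)
    also have "\<dots> \<le> (\<Prod>b\<in>UNIV. (\<Sum>y\<in>PiE J A. if b then g k y else P y) powr (if b then 1/m else (m-1)/m))"
      using m1 nonneg P0 finA by (intro sum_prod_powr_le_prod_sum_powr) (auto simp: UNIV_bool field_simps)
    also have "\<dots> = G powr (1/m) * (\<Sum>y\<in>PiE J A. P y) powr ((m-1)/m)"
      by (simp add: UNIV_bool G_def mult.commute)
    also have "\<dots> \<le> G powr (1/m) * (\<Prod>i\<in>J. h i t powr (1 / (m - 1))) powr ((m-1)/m)"
      using slice[OF False] m1 P0
      by (intro mult_left_mono powr_mono2) (auto simp: P_def sum_nonneg)
    also have "(\<Prod>i\<in>J. h i t powr (1 / (m - 1))) powr ((m-1)/m) = (\<Prod>i\<in>J. h i t powr (1/m))"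
      using m1 by (simp add: prod_powr_distrib powr_powr)
    finally show ?thesis .
  qed
  have "(\<Sum>x\<in>PiE (insert k J) A. \<Prod>i\<in>insert k J. g i x powr (1/m))
      = (\<Sum>t\<in>A k. \<Sum>y\<in>PiE J A. g k y powr (1/m) * (\<Prod>i\<in>J. g i (y(k := t)) powr (1/m)))"
    using insert.hyps by (simp add: sum_PiE_insert indep)
  also have "\<dots> \<le> (\<Sum>t\<in>A k. G powr (1/m) * (\<Prod>i\<in>J. h i t powr (1/m)))"
    by (intro sum_mono inner)
  also have "\<dots> = G powr (1/m) * (\<Sum>t\<in>A k. \<Prod>i\<in>J. h i t powr (1/m))"
    by (simp add: sum_distrib_left)
  \<comment> \<open>Hoelder over \<open>t\<close>: the \<open>m\<close> functions \<open>h i\<close>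
    carry equal weights \<open>1/m\<close>.\<close>
  also have "\<dots> \<le> G powr (1/m) * (\<Prod>i\<in>J. (\<Sum>t\<in>A k. h i t) powr (1/m))"
    using insert.hyps insert.prems(2) h0 m
    by (intro mult_left_mono sum_prod_powr_le_prod_sum_powr) (auto simp: m_def)
  also have "(\<Prod>i\<in>J. (\<Sum>t\<in>A k. h i t) powr (1/m))
      = (\<Prod>i\<in>J. (\<Sum>x\<in>PiE (insert k J - {i}) A. g i x) powr (1/m))"
  proof (rule prod.cong[OF refl])
    fix i assume "i \<in> J"
    with insert.hyps have "insert k J - {i} = insert k (J - {i})" "k \<notin> J - {i}" by auto
    then show "(\<Sum>t\<in>A k. h i t) powr (1/m) = (\<Sum>x\<in>PiE (insert k J - {i}) A. g i x) powr (1/m)"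
      by (simp add: sum_PiE_insert h_def)
  qed
  finally show ?case
    using insert.hyps m(2) by (simp add: G_def)
qed

section \<open>Exchange of coordinates in sums over pairs, and comparison of powers\<close>

lemma sum_override_on_swap:
  fixes F :: "('i \<Rightarrow> 'b) \<Rightarrow> ('i \<Rightarrow> 'b) \<Rightarrow> 'c :: comm_monoid_add"
  shows "(\<Sum>x\<in>PiE I A. \<Sum>y\<in>PiE I A. F (override_on x y S) (override_on y x S))
   = (\<Sum>x\<in>PiE I A. \<Sum>y\<in>PiE I A. F x y)"
proof -
  define sw where "sw = (\<lambda>(x :: 'i \<Rightarrow> 'b, y). (override_on x y S, override_on y x S))"
  have "(\<Sum>z\<in>PiE I A \<times> PiE I A. case sw z of (x, y) \<Rightarrow> F x y)
      = (\<Sum>z\<in>PiE I A \<times> PiE I A. case z of (x, y) \<Rightarrow> F x y)"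
    \<comment> \<open>The swap is its own inverse and maps pairs of box points to such
      pairs.\<close>
    by (rule sum.reindex_bij_witness[of _ sw sw])
       (auto simp: sw_def override_on_def PiE_iff extensional_def fun_eq_iff)
  then show ?thesis
    by (simp add: sw_def sum.cartesian_product case_prod_beta)
qed

lemma sum_PiE_insert_const:
  fixes f :: "('i \<Rightarrow> 'b) \<Rightarrow> real"
  assumes "k \<in> I" "\<And>x t. f (x(k := t)) = f x"
  shows "sum f (PiE I A) = real (card (A k)) * sum f (PiE (I - {k}) A)"
  using sum_PiE_insert[of k "I - {k}" f A] assms by (simp add: insert_absorb)

text \<open>Every single \<open>a j\<close> is at most \<open>C\<close>, so in the splitting of the
  square into powers \<open>p\<close> and \<open>2 - p\<close> the second factor can be replaced by
  \<open>C powr (2 - p)\<close>.\<close>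

lemma sum_power2_le_of_sum_powr_le:
  fixes a :: "'a \<Rightarrow> real"
  assumes "finite J" "\<And>j. j \<in> J \<Longrightarrow> a j \<ge> 0" "0 < p" "p \<le> 2" "C \<ge> 0"
    and le: "(\<Sum>j\<in>J. a j powr p) \<le> C powr p"
  shows "(\<Sum>j\<in>J. (a j)\<^sup>2) \<le> C\<^sup>2"
proof -
  have bound: "a j \<le> C" if "j \<in> J" for j
  proof -
    have "a j powr p \<le> C powr p"
      using member_le_sum[of j J "\<lambda>j. a j powr p"] that \<open>finite J\<close> le by force
    then show ?thesis
      using assms that by (metis not_le powr_less_mono2)
  qed
  have "(\<Sum>j\<in>J. (a j)\<^sup>2) = (\<Sum>j\<in>J. a j powr p * a j powr (2 - p))"
    using assms(2) by (intro sum.cong) (auto simp flip: powr_add)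
  also have "\<dots> \<le> (\<Sum>j\<in>J. a j powr p * C powr (2 - p))"
    using assms bound by (intro sum_mono mult_left_mono powr_mono2) auto
  also have "\<dots> \<le> C powr p * C powr (2 - p)"
    using le by (simp add: mult_right_mono flip: sum_distrib_right)
  also have "\<dots> = C\<^sup>2"
    using \<open>C \<ge> 0\<close> by (simp flip: powr_add)
  finally show ?thesis .
qed

section \<open>Variation along lines and in each direction\<close>

definition line_var :: "(nat \<Rightarrow> nat) \<Rightarrow> ((nat \<Rightarrow> nat) \<Rightarrow> real) \<Rightarrow> nat \<Rightarrow> (nat \<Rightarrow> nat) \<Rightarrow> real" where
  "line_var n \<theta> k x = (\<Sum>t=1..<n k. \<bar>\<theta> (x(k := Suc t)) - \<theta> (x(k := t))\<bar>)"

text \<open>Each line in direction \<open>k\<close> enters once, represented by the point whose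
  coordinate \<open>k\<close> is \<open>undefined\<close>.\<close>

definition dir_TV :: "nat \<Rightarrow> (nat \<Rightarrow> nat) \<Rightarrow> ((nat \<Rightarrow> nat) \<Rightarrow> real) \<Rightarrow> nat \<Rightarrow> real" where
  "dir_TV d n \<theta> k = (\<Sum>x\<in>PiE ({1..d} - {k}) (\<lambda>i. {1..n i}). line_var n \<theta> k x)"

lemma line_var_upd [simp]: "line_var n \<theta> k (x(k := t)) = line_var n \<theta> k x"
  by (simp add: line_var_def)

lemma line_var_nonneg [simp]: "line_var n \<theta> k x \<ge> 0"
  by (simp add: line_var_def sum_nonneg)

lemma dir_TV_nonneg [simp]: "dir_TV d n \<theta> k \<ge> 0"
  by (simp add: dir_TV_def sum_nonneg)

text \<open>Telescoping over the unit steps between \<open>s\<close> and \<open>t\<close>, which are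
  among those summed in \<open>line_var\<close>.\<close>

lemma abs_diff_le_line_var:
  assumes "s \<in> {1..n k}" "t \<in> {1..n k}"
  shows "\<bar>\<theta> (x(k := s)) - \<theta> (x(k := t))\<bar> \<le> line_var n \<theta> k x"
proof -
  have *: "\<bar>\<theta> (x(k := t)) - \<theta> (x(k := s))\<bar> \<le> line_var n \<theta> k x"
    if "s \<le> t" "1 \<le> s" "t \<le> n k" for s t
  proof -
    have "\<theta> (x(k := t)) - \<theta> (x(k := s)) = (\<Sum>i=s..<t. \<theta> (x(k := Suc i)) - \<theta> (x(k := i)))"
      using that by (simp add: sum_Suc_diff'[of s t "\<lambda>i. \<theta> (x(k := i))"])
    also have "\<bar>\<dots>\<bar> \<le> (\<Sum>i=s..<t. \<bar>\<theta> (x(k := Suc i)) - \<theta> (x(k := i))\<bar>)"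
      by (rule sum_abs)
    also have "\<dots> \<le> line_var n \<theta> k x"
      unfolding line_var_def using that by (intro sum_mono2) auto
    finally show ?thesis .
  qed
  show ?thesis
    using *[of s t] *[of t s] assms by (cases "s \<le> t") (auto simp: abs_minus_commute)
qed

lemma sum_grid_line_var:
  assumes "k \<in> {1..d}"
  shows "(\<Sum>x\<in>grid d n. line_var n \<theta> k x) = real (n k) * dir_TV d n \<theta> k"
  unfolding grid_def dir_TV_def using assms by (subst sum_PiE_insert_const[of k]) auto

text \<open>The terms on the left are edge differences, and \<open>E\<close> sends distinct index
  triples to distinct edges, so the left side is a partial sum of the nonnegative terms of
  \<open>TV\<close>.\<close>

lemma sum_dir_TV_le_TV: "(\<Sum>k\<in>{1..d}. dir_TV d n \<theta> k) \<le> TV d n \<theta>"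
proof -
  define D where "D = (SIGMA k:{1..d}. PiE ({1..d} - {k}) (\<lambda>i. {1..n i}) \<times> {1..<n k})"
  define E where "E = (\<lambda>(k, x :: nat \<Rightarrow> nat, t). {x(k := t), x(k := Suc t)})"
  have inj: "inj_on E D"
  proof (rule inj_onI)
    fix a b assume ab: "a \<in> D" "b \<in> D" "E a = E b"
    obtain k x t where a: "a = (k, x, t)" by (cases a)
    obtain k' x' t' where b: "b = (k', x', t')" by (cases b)
    \<comment> \<open>A base point is \<open>undefined\<close> in its own direction, so it can be
      recovered from either endpoint of the edge.\<close>
    have x: "x k = undefined" "x' k' = undefined"
      using ab by (auto simp: a b D_def PiE_def extensional_def)
    from ab(3) consider
      (same) "x(k := t) = x'(k' := t')" "x(k := Suc t) = x'(k' := Suc t')"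
      | (opp) "x(k := t) = x'(k' := Suc t')" "x(k := Suc t) = x'(k' := t')"
      by (auto simp: a b E_def doubleton_eq_iff)
    then show "a = b"
    proof cases
      case same
      \<comment> \<open>Otherwise \<open>x' k\<close> would equal both \<open>t\<close> and
        \<open>Suc t\<close>.\<close>
      have "k = k'"
        using fun_cong[OF same(1), of k] fun_cong[OF same(2), of k] by (auto split: if_splits)
      moreover have "t = t'"
        using fun_cong[OF same(1), of k] \<open>k = k'\<close> by simp
      moreover have "x = x'"
        using same(1) x \<open>k = k'\<close> by (metis fun_upd_triv fun_upd_upd)
      ultimately show ?thesis by (simp add: a b)
    next
      case opp
      \<comment> \<open>Impossible: coordinate \<open>k\<close> gives \<open>t = Suc t'\<close> and
        \<open>Suc t = t'\<close> if the directions agree, and \<open>t = Suc t\<close> if they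
        differ.\<close>
      show ?thesis
        using fun_cong[OF opp(1), of k] fun_cong[OF opp(2), of k] by (auto split: if_splits)
    qed
  qed
  have sub: "E ` D \<subseteq> grid_edges d n"
  proof (rule image_subsetI)
    fix a assume a: "a \<in> D"
    obtain k x t where eq: "a = (k, x, t)" by (cases a)
    have k: "k \<in> {1..d}" "t \<in> {1..<n k}" and x: "x \<in> PiE ({1..d} - {k}) (\<lambda>i. {1..n i})"
      using a by (auto simp: eq D_def)
    have "insert k ({1..d} - {k}) = {1..d}"
      using k by auto
    then have "x(k := s) \<in> grid d n" if "s \<in> {1..n k}" for s
      using PiE_fun_upd[of s "\<lambda>i. {1..n i}" k x "{1..d} - {k}"] x that by (simp add: grid_def)
    then have "x(k := t) \<in> grid d n" "x(k := Suc t) \<in> grid d n"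
      using k by auto
    moreover have "l1_dist d (x(k := t)) (x(k := Suc t)) = 1"
    proof -
      have "l1_dist d (x(k := t)) (x(k := Suc t)) = (\<Sum>i\<in>{1..d}. if i = k then 1 else 0)"
        unfolding l1_dist_def by (intro sum.cong) auto
      then show ?thesis
        using k by simp
    qed
    ultimately show "E a \<in> grid_edges d n"
      unfolding eq E_def grid_edges_def by auto
  qed
  have "(\<Sum>k\<in>{1..d}. dir_TV d n \<theta> k) = (\<Sum>a\<in>D. edge_diff \<theta> (E a))"
    unfolding D_def dir_TV_def line_var_def sum.cartesian_product
    by (subst sum.Sigma) (auto simp: E_def case_prod_beta abs_minus_commute intro!: finite_PiE sum.cong)
  also have "\<dots> = sum (edge_diff \<theta>) (E ` D)"
    by (simp add: sum.reindex[OF inj])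
  also have "\<dots> \<le> TV d n \<theta>"
    unfolding TV_def by (intro sum_mono2 sub finite_grid_edges) (auto simp: grid_edges_def)
  finally show ?thesis .
qed

section \<open>Average cost of changing a set of coordinates\<close>

lemma sum_override_on_diff_le:
  assumes "S \<subseteq> {1..d}"
  shows "(\<Sum>x\<in>grid d n. \<Sum>y\<in>grid d n. \<bar>\<theta> x - \<theta> (override_on x y S)\<bar>)
    \<le> real (card (grid d n)) * (\<Sum>k\<in>S. real (n k) * dir_TV d n \<theta> k)"
proof -
  have "finite S"
    using assms finite_subset by blast
  then show ?thesis
    using assms
  proof (induction S rule: finite_induct)
    case empty
    then show ?case by simp
  next
    case (insert k S)
    have k: "k \<in> {1..d}"
      using insert.prems by simp
    have step: "\<bar>\<theta> x - \<theta> (override_on x y (insert k S))\<bar>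
      \<le> \<bar>\<theta> x - \<theta> (override_on x y S)\<bar> + line_var n \<theta> k (override_on x y S)"
      if "x \<in> grid d n" "y \<in> grid d n" for x y
    proof -
      define z where "z = override_on x y S"
      \<comment> \<open>As \<open>k\<close> is not in \<open>S\<close>, the mixed point
        \<open>z\<close> still has the coordinate \<open>k\<close> of \<open>x\<close>; passing to
        \<open>y k\<close> is a move along one line.\<close>
      have z: "override_on x y (insert k S) = z(k := y k)" "z = z(k := x k)"
        using insert.hyps by (auto simp: z_def override_on_def)
      have "x k \<in> {1..n k}" "y k \<in> {1..n k}"
        using that k by (auto simp: grid_def PiE_iff)
      from abs_diff_le_line_var[where n = n and k = k and \<theta> = \<theta> and x = z, OF this] z(2)
      have "\<bar>\<theta> z - \<theta> (z(k := y k))\<bar> \<le> line_var n \<theta> k z"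
        by simp
      then show ?thesis
        unfolding z(1) z_def[symmetric] by linarith
    qed
    have "(\<Sum>x\<in>grid d n. \<Sum>y\<in>grid d n. \<bar>\<theta> x - \<theta> (override_on x y (insert k S))\<bar>)
        \<le> (\<Sum>x\<in>grid d n. \<Sum>y\<in>grid d n.
              \<bar>\<theta> x - \<theta> (override_on x y S)\<bar> + line_var n \<theta> k (override_on x y S))"
      by (intro sum_mono step)
    \<comment> \<open>The swap of the coordinates in \<open>S\<close> replaces the mixed point by
      \<open>x\<close> in the line variation.\<close>
    also have "\<dots> = (\<Sum>x\<in>grid d n. \<Sum>y\<in>grid d n. \<bar>\<theta> x - \<theta> (override_on x y S)\<bar>)
        + (\<Sum>x\<in>grid d n. \<Sum>y\<in>grid d n. line_var n \<theta> k x)"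
      using sum_override_on_swap[of "\<lambda>x y. line_var n \<theta> k x" S "{1..d}" "\<lambda>i. {1..n i}"]
      by (simp add: sum.distrib grid_def)
    also have "(\<Sum>x\<in>grid d n. \<Sum>y\<in>grid d n. line_var n \<theta> k x)
        = real (card (grid d n)) * (real (n k) * dir_TV d n \<theta> k)"
      using k by (simp add: sum_grid_line_var flip: sum_distrib_left)
    finally show ?case
      using insert by (simp add: distrib_left)
  qed
qed

section \<open>Bounding the deviation from the mean in each direction\<close>

lemma card_grid: "real (card (grid d n)) = (\<Prod>i\<in>{1..d}. real (n i))"
  by (simp add: grid_def card_PiE)

text \<open>The function \<open>g i\<close> of the overview. Both terms read \<open>x\<close> only
  after its coordinate \<open>i\<close> is overwritten, which gives the independence that
  \<open>Loomis_Whitney_sum\<close> asks for.\<close>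

definition dev_bound :: "nat \<Rightarrow> (nat \<Rightarrow> nat) \<Rightarrow> ((nat \<Rightarrow> nat) \<Rightarrow> real) \<Rightarrow> nat \<Rightarrow> (nat \<Rightarrow> nat) \<Rightarrow> real" where
  "dev_bound d n \<theta> i x = line_var n \<theta> i x
     + (\<Sum>y\<in>grid d n. \<bar>\<theta> (x(i := y i)) - \<theta> y\<bar>) / real (card (grid d n))"

lemma dev_bound_upd [simp]: "dev_bound d n \<theta> i (x(i := t)) = dev_bound d n \<theta> i x"
  by (simp add: dev_bound_def)

lemma dev_bound_nonneg [simp]: "dev_bound d n \<theta> i x \<ge> 0"
  by (simp add: dev_bound_def sum_nonneg)

text \<open>For each \<open>y\<close>, the triangle inequality through \<open>x(i := y i)\<close>,
  followed by averaging over \<open>y\<close>.\<close>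

lemma abs_diff_grid_mean_le_dev_bound:
  assumes "x \<in> grid d n" "i \<in> {1..d}"
  shows "\<bar>\<theta> x - grid_mean d n \<theta>\<bar> \<le> dev_bound d n \<theta> i x"
proof -
  define N where "N = real (card (grid d n))"
  have N: "N > 0"
    using assms(1) by (auto simp: N_def card_gt_0_iff)
  have step: "\<bar>\<theta> x - \<theta> y\<bar> \<le> line_var n \<theta> i x + \<bar>\<theta> (x(i := y i)) - \<theta> y\<bar>" if "y \<in> grid d n" for y
  proof -
    have "x i \<in> {1..n i}" "y i \<in> {1..n i}"
      using assms that by (auto simp: grid_def PiE_iff)
    from abs_diff_le_line_var[where n = n and k = i and \<theta> = \<theta> and x = x, OF this] show ?thesis
      by simp
  qed
  have "N * (\<theta> x - grid_mean d n \<theta>) = (\<Sum>y\<in>grid d n. \<theta> x - \<theta> y)"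
    unfolding grid_mean_def card_grid[symmetric] N_def[symmetric]
    using N by (simp add: sum_subtractf right_diff_distrib flip: N_def)
  then have "N * \<bar>\<theta> x - grid_mean d n \<theta>\<bar> = \<bar>\<Sum>y\<in>grid d n. \<theta> x - \<theta> y\<bar>"
    using N by (metis abs_mult abs_of_pos)
  also have "\<dots> \<le> (\<Sum>y\<in>grid d n. line_var n \<theta> i x + \<bar>\<theta> (x(i := y i)) - \<theta> y\<bar>)"
    by (intro order_trans[OF sum_abs] sum_mono step)
  also have "\<dots> = N * dev_bound d n \<theta> i x"
    using N by (simp add: dev_bound_def sum.distrib distrib_left flip: N_def)
  finally show ?thesis
    using N by simp
qed

text \<open>The sum is estimated over the whole grid, where it is \<open>n i\<close> times as large.
  There the line variation yields the term \<open>k = i\<close> and the average yields the terms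
  with \<open>k\<close> different from \<open>i\<close>.\<close>

lemma sum_dev_bound_le:
  assumes "\<And>i. i \<in> {1..d} \<Longrightarrow> n i \<ge> 1" "i \<in> {1..d}"
  shows "(\<Sum>x\<in>PiE ({1..d} - {i}) (\<lambda>i. {1..n i}). dev_bound d n \<theta> i x)
    \<le> (\<Sum>k\<in>{1..d}. real (n k) / real (n i) * dir_TV d n \<theta> k)"
proof -
  define N where "N = real (card (grid d n))"
  have N: "N > 0"
    using assms(1) by (force simp: N_def card_grid intro!: prod_pos)
  \<comment> \<open>Exchanging coordinate \<open>i\<close> between \<open>x\<close> and
    \<open>y\<close> turns the pair \<open>x(i := y i)\<close>, \<open>y\<close> into
    \<open>x\<close>, \<open>y(i := x i)\<close>. The latter point is \<open>x\<close> with all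
    coordinates but \<open>i\<close> taken from \<open>y\<close>.\<close>
  have "(\<Sum>x\<in>grid d n. \<Sum>y\<in>grid d n. \<bar>\<theta> (x(i := y i)) - \<theta> y\<bar>)
      = (\<Sum>x\<in>grid d n. \<Sum>y\<in>grid d n. \<bar>\<theta> (override_on x y {i}) -
           \<theta> ((override_on y x {i})(i := override_on x y {i} i))\<bar>)"
    by (intro sum.cong) (auto simp: override_on_def fun_upd_def if_distrib cong: if_cong
          intro!: arg_cong2[where f = "\<lambda>a b. \<bar>\<theta> a - \<theta> b\<bar>"])
  also have "\<dots> = (\<Sum>x\<in>grid d n. \<Sum>y\<in>grid d n. \<bar>\<theta> x - \<theta> (y(i := x i))\<bar>)"
    unfolding grid_def by (rule sum_override_on_swap)
  also have "\<dots> = (\<Sum>x\<in>grid d n. \<Sum>y\<in>grid d n. \<bar>\<theta> x - \<theta> (override_on x y ({1..d} - {i}))\<bar>)"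
  proof (intro sum.cong refl)
    fix x y assume "x \<in> grid d n" "y \<in> grid d n"
    \<comment> \<open>Outside \<open>{1..d}\<close> both sides agree because grid points are
      \<open>undefined\<close> there.\<close>
    then have "y(i := x i) = override_on x y ({1..d} - {i})"
      by (auto simp: grid_def PiE_iff extensional_def override_on_def fun_eq_iff)
    then show "\<bar>\<theta> x - \<theta> (y(i := x i))\<bar> = \<bar>\<theta> x - \<theta> (override_on x y ({1..d} - {i}))\<bar>"
      by simp
  qed
  also have "\<dots> \<le> N * (\<Sum>k\<in>{1..d} - {i}. real (n k) * dir_TV d n \<theta> k)"
    unfolding N_def by (rule sum_override_on_diff_le) auto
  finally have "(\<Sum>x\<in>grid d n. \<Sum>y\<in>grid d n. \<bar>\<theta> (x(i := y i)) - \<theta> y\<bar>) / N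
      \<le> (\<Sum>k\<in>{1..d} - {i}. real (n k) * dir_TV d n \<theta> k)"
    using N by (simp add: field_simps)
  then have "(\<Sum>x\<in>grid d n. dev_bound d n \<theta> i x) \<le> (\<Sum>k\<in>{1..d}. real (n k) * dir_TV d n \<theta> k)"
    using assms(2)
    by (simp add: dev_bound_def sum.distrib sum_grid_line_var sum.remove[of _ i] flip: sum_divide_distrib N_def)
  moreover have "(\<Sum>x\<in>grid d n. dev_bound d n \<theta> i x)
      = real (n i) * (\<Sum>x\<in>PiE ({1..d} - {i}) (\<lambda>i. {1..n i}). dev_bound d n \<theta> i x)"
    unfolding grid_def using assms(2) by (subst sum_PiE_insert_const[of i]) auto
  moreover have "real (n i) > 0"
    using assms(1)[OF assms(2)] by simp
  ultimately show ?thesis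
    by (simp add: pos_le_divide_eq mult.commute flip: sum_divide_distrib)
qed

section \<open>Combination of the bounds\<close>

lemma aspect_ratio_ge:
  assumes "i \<in> {1..d}" "j \<in> {1..d}"
  shows "real (n i) / real (n j) \<le> aspect_ratio d n"
  unfolding aspect_ratio_def using assms by (intro Max_ge finite_image_set2) auto

theorem proposition8p7:
  fixes d :: nat and n :: "nat \<Rightarrow> nat" and \<theta> :: "(nat \<Rightarrow> nat) \<Rightarrow> real"
  assumes "d \<ge> 2" and "\<forall>i\<in>{1..d}. n i \<ge> 1"
  shows "(\<Sum>j\<in>grid d n. \<bar>\<theta> j - grid_mean d n \<theta>\<bar> powr (real d / (real d - 1)))
           \<le> (1 + aspect_ratio d n) powr (real d / (real d - 1))
             * TV d n \<theta> powr (real d / (real d - 1))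
       \<and> (\<Sum>j\<in>grid d n. \<bar>\<theta> j - grid_mean d n \<theta>\<bar>\<^sup>2)
           \<le> (1 + aspect_ratio d n)\<^sup>2 * (TV d n \<theta>)\<^sup>2"
proof -
  define R where "R = aspect_ratio d n"
  define C where "C = (1 + R) * TV d n \<theta>"
  define q where "q = 1 / (real d - 1)"
  define p where "p = real d / (real d - 1)"
  have q: "q > 0" and p: "0 < p" "p \<le> 2" and pq: "real d * q = p"
    using assms(1) by (auto simp: q_def p_def field_simps)
  have "d > 0"
    using assms(1) by simp
  then have powr_q: "(\<Prod>i\<in>{1..d}. c powr q) = c powr p" for c :: real
    by (cases "c = 0") (simp_all add: powr_power flip: pq)
  \<comment> \<open>The pair of equal indices contributes the ratio 1 to the maximum.\<close>
  have "real (n 1) / real (n 1) \<le> R"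
    unfolding R_def using assms(1) by (intro aspect_ratio_ge) auto
  moreover have "n 1 \<ge> 1"
    using assms by simp
  ultimately have R: "R \<ge> 1"
    by simp
  have TV0: "TV d n \<theta> \<ge> 0"
    using sum_dir_TV_le_TV[where d=d and n=n and \<theta>=\<theta>] by (meson dir_TV_nonneg order_trans sum_nonneg)
  have C0: "C \<ge> 0"
    using R TV0 by (simp add: C_def)
  have proj: "(\<Sum>x\<in>PiE ({1..d} - {i}) (\<lambda>i. {1..n i}). dev_bound d n \<theta> i x) \<le> C"
    if "i \<in> {1..d}" for i
  proof -
    have "(\<Sum>x\<in>PiE ({1..d} - {i}) (\<lambda>i. {1..n i}). dev_bound d n \<theta> i x)
        \<le> (\<Sum>k\<in>{1..d}. real (n k) / real (n i) * dir_TV d n \<theta> k)"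
      using assms(2) that by (intro sum_dev_bound_le) auto
    \<comment> \<open>Each ratio is at most \<open>R\<close>, hence at most
      \<open>1 + R\<close>.\<close>
    also have "\<dots> \<le> (\<Sum>k\<in>{1..d}. (1 + R) * dir_TV d n \<theta> k)"
      using that aspect_ratio_ge[of _ d i n]
      by (intro sum_mono mult_right_mono) (auto simp: R_def add_increasing)
    also have "\<dots> \<le> C"
      unfolding C_def sum_distrib_left[symmetric]
      using R by (intro mult_left_mono sum_dir_TV_le_TV) auto
    finally show ?thesis .
  qed
  \<comment> \<open>Since \<open>p = d * q\<close>, the power splits into \<open>d\<close> equal
    factors, and the factor with index \<open>i\<close> is bounded by means of direction
    \<open>i\<close>.\<close>
  have "(\<Sum>j\<in>grid d n. \<bar>\<theta> j - grid_mean d n \<theta>\<bar> powr p)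
      = (\<Sum>j\<in>grid d n. \<Prod>i\<in>{1..d}. \<bar>\<theta> j - grid_mean d n \<theta>\<bar> powr q)"
    by (simp only: powr_q)
  also have "\<dots> \<le> (\<Sum>j\<in>grid d n. \<Prod>i\<in>{1..d}. dev_bound d n \<theta> i j powr q)"
    using q by (intro sum_mono prod_mono conjI powr_mono2 abs_diff_grid_mean_le_dev_bound) auto
  also have "\<dots> \<le> (\<Prod>i\<in>{1..d}. (\<Sum>x\<in>PiE ({1..d} - {i}) (\<lambda>i. {1..n i}). dev_bound d n \<theta> i x) powr q)"
    using Loomis_Whitney_sum[of "{1..d}" "\<lambda>i. {1..n i}" "dev_bound d n \<theta>"] assms(1)
    by (simp add: grid_def q_def)
  also have "\<dots> \<le> (\<Prod>i\<in>{1..d}. C powr q)"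
    using q proj by (intro prod_mono conjI powr_mono2) (auto intro: sum_nonneg)
  also have "\<dots> = C powr p"
    by (rule powr_q)
  finally have main: "(\<Sum>j\<in>grid d n. \<bar>\<theta> j - grid_mean d n \<theta>\<bar> powr p) \<le> C powr p" .
  then have "(\<Sum>j\<in>grid d n. \<bar>\<theta> j - grid_mean d n \<theta>\<bar>\<^sup>2) \<le> C\<^sup>2"
    using p C0 by (intro sum_power2_le_of_sum_powr_le) auto
  with main show ?thesis
    using R TV0 by (simp add: C_def R_def p_def powr_mult power_mult_distrib)
qed

end
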